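(* Let $p$ be a prime, $q$ a power of $p$, $K=\mathbb{F}_q(T)$, $d\geq2$ an integer with $p\nmid d$, $a\in K^\times\setminus\mathbb{F}_q$, $f=\mathrm{ord}_d(q)$ and $\bar f=\mathrm{ord}_{d(h,d^\infty)}(q)$. Put $C=\frac34+2^{-v_2(q^{\bar f}+1)-1}$. Assume that $f_{u,v}=\mathrm{ord}_{dv}(q)$ for all $u\mid d$ and $v\mid d^\infty$. Then \[ \delta_q(a,d)=\frac1{\bar f}\prod_{l\mid d}\left(1-\frac{l^{v_l(dh)}\,C^{[l=2]\cdot[\mathcal{P}]}}{(l+1)\,l^{v_l(q^{\bar f}-1)}}\right), \] the product being over primes $l$ dividing $d$.
   Context: $w\mid d^\infty$ means $w$ is a positive integer dividing a power of $d$; $(k,d^\infty)=\prod_{l\mid d}l^{v_l(k)}$. Write $a=\lambda\tilde a$, $\lambda\in\mathbb{F}_q^\times$, with $\tilde a=\tilde f/\tilde g$ for $a=f/g$, $f,g\in\mathbb{F}_q[T]$, $\tilde f,\tilde g$ the monic parts; $h$ is the largest integer $t\ge1$ with $\tilde a\in(K^\times)^t$. For $r\mid m$, $p\nmid m$, $\mathbb{F}_{m,r}$ is the constant field of $K(\zeta_m,a^{1/r})$ ($\zeta_m$ a primitive $m$-th root of unity in $\bar{\mathbb{F}}_q$), and $f_{u,v}=[\mathbb{F}_{dv,uv}:\mathbb{F}_q]$. $e_n=\big(\frac{q^n-1}{d},d^\infty\big)$ for $f\mid n$. For $w\mid d^\infty$, $\delta_w=\sum_{v\mid e_{fw}}\sum_{u\mid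 d}\frac{\mu(u)(uv,h)}{uv}[f_{u,v}\mid fw]$, and $\delta_q(a,d)=\frac{\varphi(d)}{df}\sum_{w\mid d^\infty}\frac{\delta_w}{w}$. $\mathcal{P}$ is the proposition "$2\,\|\,d$, $q\equiv3\pmod4$ and $f$ is odd"; $[\cdot]$ is the Iverson bracket (1 if true, 0 otherwise). *)

theory Defs
  imports
    "HOL-Algebra.Algebraic_Closure_Type"
    "HOL-Algebra.Generated_Fields"
    "HOL-Number_Theory.Number_Theory"
    "HOL-Analysis.Infinite_Sum"
    "HOL-Library.Cardinality"
begin

text \<open>
  A finite field with \<open>q\<close> elements is a type \<open>'a :: {field, finite}\<close> with \<open>q = CARD('a)\<close>;
  the rational function field \<open>K\<close> over it is \<open>'a poly fract\<close>, and all extensions of \<open>K\<close> are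
  taken inside its algebraic closure \<open>'a poly fract alg_closure\<close>.
\<close>

section \<open>Arithmetic notation\<close>

definition moebius_mu :: "nat \<Rightarrow> real" where
  "moebius_mu n = (if squarefree n then (- 1) ^ card (prime_factors n) else 0)"

text \<open>The relation \<open>w | d\<^sup>\<infinity>\<close>.\<close>

definition dvd_infty :: "nat \<Rightarrow> nat \<Rightarrow> bool" where
  "dvd_infty w d \<longleftrightarrow> w > 0 \<and> (\<exists>k. w dvd d ^ k)"

text \<open>The number \<open>(k, d\<^sup>\<infinity>)\<close>.\<close>

definition gcd_infty :: "nat \<Rightarrow> nat \<Rightarrow> nat" where
  "gcd_infty k d = (\<Prod>l\<in>prime_factors d. l ^ multiplicity l k)"


section \<open>Constants, monic parts and the exponent \<open>h\<close>\<close>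

definition const_fract :: "'a::field \<Rightarrow> 'a poly fract" where
  "const_fract c = Fract [:c:] 1"

definition monic_poly :: "'a::field poly \<Rightarrow> 'a poly" where
  "monic_poly f = smult (inverse (Polynomial.lead_coeff f)) f"

lemma monic_poly_mult: "monic_poly (f * g) = monic_poly f * monic_poly g"
  by (simp add: monic_poly_def Polynomial.lead_coeff_mult field_simps)

lemma monic_poly_eq_0_iff [simp]: "monic_poly f = 0 \<longleftrightarrow> f = 0"
  by (simp add: monic_poly_def)

text \<open>If \<open>a = f / g\<close>, then its monic part is the quotient of the monic parts of \<open>f\<close> and \<open>g\<close>.\<close>

definition monic_part :: "'a::field poly fract \<Rightarrow> 'a poly fract" where
  "monic_part a =
     (THE b. \<exists>f g. g \<noteq> 0 \<and> a = Fract f g \<and> b = Fract (monic_poly f) (monic_poly g))"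

lemma monic_part_Fract:
  assumes "g \<noteq> 0"
  shows "monic_part (Fract f g) = Fract (monic_poly f) (monic_poly g)"
  unfolding monic_part_def
proof (rule the_equality)
  show "\<exists>f' g'. g' \<noteq> 0 \<and> Fract f g = Fract f' g' \<and>
          Fract (monic_poly f) (monic_poly g) = Fract (monic_poly f') (monic_poly g')"
    using assms by blast
next
  fix b
  assume "\<exists>f' g'. g' \<noteq> 0 \<and> Fract f g = Fract f' g' \<and> b = Fract (monic_poly f') (monic_poly g')"
  then obtain f' g' where *: "g' \<noteq> 0" "Fract f g = Fract f' g'"
      "b = Fract (monic_poly f') (monic_poly g')"
    by blast
  hence "f * g' = f' * g"
    using assms by (simp add: eq_fract)
  hence "monic_poly f * monic_poly g' = monic_poly f' * monic_poly g"
    by (simp flip: monic_poly_mult)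
  thus "b = Fract (monic_poly f) (monic_poly g)"
    using * assms by (simp add: eq_fract)
qed

definition max_exponent :: "'a::field poly fract \<Rightarrow> nat" where
  "max_exponent a = (GREATEST t. t \<ge> 1 \<and> (\<exists>b. b \<noteq> 0 \<and> monic_part a = b ^ t))"


section \<open>Constant fields of Kummer extensions\<close>

definition primitive_root_of_unity :: "nat \<Rightarrow> 'b::field \<Rightarrow> bool" where
  "primitive_root_of_unity m z \<longleftrightarrow> m > 0 \<and> z ^ m = 1 \<and> (\<forall>k. 0 < k \<and> k < m \<longrightarrow> z ^ k \<noteq> 1)"

definition base_constants :: "'a::field poly fract alg_closure set" where
  "base_constants = range (\<lambda>c. to_ac (const_fract c))"

text \<open>
  For \<open>r | m\<close> and \<open>m\<close> coprime to the characteristic, both choices exist and the generated field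
  does not depend on them, since it contains all \<open>m\<close>-th roots of unity.
\<close>

definition kummer_field ::
  "'a::field poly fract \<Rightarrow> nat \<Rightarrow> nat \<Rightarrow> 'a poly fract alg_closure set" where
  "kummer_field a m r =
     generate_field ring_of_type_algebra
       (range to_ac \<union> {SOME z. primitive_root_of_unity m z, SOME b. b ^ r = to_ac a})"

definition constant_field ::
  "'a::field poly fract \<Rightarrow> nat \<Rightarrow> nat \<Rightarrow> 'a poly fract alg_closure set" where
  "constant_field a m r =
     {x \<in> kummer_field a m r. (ring.algebraic ring_of_type_algebra over base_constants) x}"

text \<open>The degree \<open>f\<^bsub>u,v\<^esub>\<close>.\<close>

definition constant_degree :: "'a::field poly fract \<Rightarrow> nat \<Rightarrow> nat \<Rightarrow> nat \<Rightarrow> nat" where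
  "constant_degree a d u v =
     (ring.dim ring_of_type_algebra over base_constants) (constant_field a (d * v) (u * v))"


section \<open>The density\<close>

text \<open>The number \<open>e\<^sub>n\<close>, used only when \<open>ord d q\<close> divides \<open>n\<close>, so that the division is exact.\<close>

definition e_part :: "nat \<Rightarrow> nat \<Rightarrow> nat \<Rightarrow> nat" where
  "e_part q d n = gcd_infty ((q ^ n - 1) div d) d"

definition delta_w :: "'a::{field, finite} poly fract \<Rightarrow> nat \<Rightarrow> nat \<Rightarrow> real" where
  "delta_w a d w =
     (let q = CARD('a); f = ord d q; h = max_exponent a in
      \<Sum>v | v dvd e_part q d (f * w). \<Sum>u | u dvd d.
        moebius_mu u * real (gcd (u * v) h) / real (u * v) *
        of_bool (constant_degree a d u v dvd f * w))"

definition delta_q :: "'a::{field, finite} poly fract \<Rightarrow> nat \<Rightarrow> real" where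
  "delta_q a d =
     real (totient d) / (real d * real (ord d CARD('a))) *
     (\<Sum>\<^sub>\<infinity>w\<in>{w. dvd_infty w d}. delta_w a d w / real w)"

definition prop_P :: "nat \<Rightarrow> nat \<Rightarrow> bool" where
  "prop_P q d \<longleftrightarrow> 2 dvd d \<and> \<not> 4 dvd d \<and> q mod 4 = 3 \<and> odd (ord d q)"

end

theory Submission
  imports Defs
begin

text \<open>
  Since \<open>f\<^bsub>u,v\<^esub> = ord\<^bsub>dv\<^esub> q\<close> and \<open>v | e\<^bsub>fw\<^esub>\<close> means \<open>dv | q\<^bsup>fw\<^esup> - 1\<close>, every Iverson bracket
  in \<open>\<delta>\<^sub>w\<close> equals 1. The double sum is then multiplicative and telescopes over the exponents at each
  prime \<open>l | d\<close>: \<open>\<delta>\<^sub>w\<close> vanishes unless \<open>d (h, d\<^sup>\<infinity>) | q\<^bsup>fw\<^esup> - 1\<close>, that is, unless the order of \<open>q\<close>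
  modulo \<open>d (h, d\<^sup>\<infinity>)\<close> divides \<open>fw\<close>, and otherwise it is the product over \<open>l | d\<close> of
  \<open>1 - l\<^bsup>v(dh) - v(q^(fw) - 1) - 1\<^esup>\<close>, where \<open>v\<close> is the \<open>l\<close>-adic valuation. Lifting the exponent makes
  these factors depend only on \<open>v(w)\<close>, so the sum over \<open>w\<close> is an Euler product of geometric series.
  For \<open>l = 2\<close> the lifting formula is exceptional when \<open>Q \<equiv> 3 (mod 4)\<close>, \<open>Q\<close> being \<open>q\<close> to the power of
  that order. This forces \<open>\<P>\<close>, while under \<open>\<P>\<close> with \<open>Q \<equiv> 1 (mod 4)\<close> the constant \<open>C\<close> is 1.
\<close>

section \<open>Sums over integers with prescribed prime factors\<close>

lemma prod_primes_multiplicity: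
  fixes n :: nat
  assumes "n > 0" "finite S" "\<And>l. l \<in> S \<Longrightarrow> prime l" "prime_factors n \<subseteq> S"
  shows "(\<Prod>l\<in>S. l ^ multiplicity l n) = n"
proof -
  have "(\<Prod>l\<in>S. l ^ multiplicity l n) = (\<Prod>l\<in>prime_factors n. l ^ multiplicity l n)"
    using assms by (intro prod.mono_neutral_right) (auto simp: prime_factors_multiplicity)
  also have "\<dots> = n"
    using prod_prime_factors[of n] assms(1) by simp
  finally show ?thesis .
qed

text \<open>The sets \<open>B l\<close> are left arbitrary so that unique factorization serves
  twice: \<open>{..multiplicity l n}\<close> yields the divisors of \<open>n\<close>, and
  \<open>UNIV\<close> yields all integers whose primes lie in \<open>S\<close>.\<close>

lemma bij_betw_prod_prime_powers:
  fixes S :: "nat set"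
  assumes "finite S" and S: "\<And>l. l \<in> S \<Longrightarrow> prime l"
  shows "bij_betw (\<lambda>g. \<Prod>l\<in>S. l ^ g l) (PiE S B)
           {n. n > 0 \<and> prime_factors n \<subseteq> S \<and> (\<forall>l\<in>S. multiplicity l n \<in> B l)}"
    (is "bij_betw ?F _ ?N")
proof (rule bij_betw_byWitness[where f' = "\<lambda>n. \<lambda>l\<in>S. multiplicity l n"])
  have mult: "multiplicity l (?F g) = (if l \<in> S then g l else 0)" if "prime l" for l g
    using assms that by (rule multiplicity_prod_prime_powers)
  show "\<forall>g\<in>PiE S B. (\<lambda>l\<in>S. multiplicity l (?F g)) = g"
  proof (intro ballI ext)
    fix g l assume "g \<in> PiE S B"
    then show "(\<lambda>l\<in>S. multiplicity l (?F g)) l = g l"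
      by (cases "l \<in> S") (simp_all add: mult S PiE_arb[of g S B])
  qed
  show "\<forall>n\<in>?N. ?F (\<lambda>l\<in>S. multiplicity l n) = n"
    by (auto intro: prod_primes_multiplicity assms)
  have "?F g > 0" for g
    by (intro prod_pos) (simp add: S prime_gt_0_nat)
  moreover have "prime_factors (?F g) \<subseteq> S" for g
    by (auto simp: prime_factors_multiplicity mult split: if_splits)
  moreover have "multiplicity l (?F g) \<in> B l" if "g \<in> PiE S B" "l \<in> S" for g l
    using that by (auto simp: mult S)
  ultimately show "?F ` PiE S B \<subseteq> ?N"
    by blast
  show "(\<lambda>n. \<lambda>l\<in>S. multiplicity l n) ` ?N \<subseteq> PiE S B"
    by auto
qed

text \<open>Distributivity turns the product of sums into a sum over exponent vectors, hence over
  divisors. A prime of \<open>S\<close> not dividing \<open>n\<close> contributes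
  \<open>G l 0\<close> on both sides, so a divisor of a power of \<open>d\<close> may be treated
  with all primes of \<open>d\<close> at once.\<close>

lemma sum_divisors_prod:
  fixes G :: "nat \<Rightarrow> nat \<Rightarrow> 'a::comm_semiring_1"
  assumes "n > 0" "finite S" and S: "\<And>l. l \<in> S \<Longrightarrow> prime l" and "prime_factors n \<subseteq> S"
  shows "(\<Sum>v | v dvd n. \<Prod>l\<in>S. G l (multiplicity l v)) = (\<Prod>l\<in>S. \<Sum>k\<le>multiplicity l n. G l k)"
proof -
  let ?B = "\<lambda>l. {..multiplicity l n}"
  have eq: "{v. v dvd n} =
      {v. v > 0 \<and> prime_factors v \<subseteq> S \<and> (\<forall>l\<in>S. multiplicity l v \<in> ?B l)}"
  proof (intro equalityI subsetI; clarsimp)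
    fix v assume "v dvd n"
    then show "v > 0 \<and> prime_factors v \<subseteq> S \<and> (\<forall>l\<in>S. multiplicity l v \<le> multiplicity l n)"
      using assms dvd_prime_factors[of n v] by (auto intro: dvd_imp_multiplicity_le dvd_pos_nat)
  next
    fix v assume v: "0 < v" "prime_factors v \<subseteq> S" "\<forall>l\<in>S. multiplicity l v \<le> multiplicity l n"
    show "v dvd n"
    proof (rule multiplicity_le_imp_dvd)
      fix l :: nat assume "prime l"
      then show "multiplicity l v \<le> multiplicity l n"
        using v by (cases "l \<in> S") (auto simp: prime_factors_multiplicity)
    qed (use v in auto)
  qed
  have "(\<Prod>l\<in>S. \<Sum>k\<le>multiplicity l n. G l k) = (\<Sum>g\<in>PiE S ?B. \<Prod>l\<in>S. G l (g l))"
    using assms(2) by (intro prod_sum_PiE) auto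
  also have "\<dots> = (\<Sum>g\<in>PiE S ?B. \<Prod>l\<in>S. G l (multiplicity l (\<Prod>l\<in>S. l ^ g l)))"
    using S by (intro sum.cong prod.cong refl) (simp add: multiplicity_prod_prime_powers[OF assms(2)])
  also have "\<dots> = (\<Sum>v | v dvd n. \<Prod>l\<in>S. G l (multiplicity l v))"
    unfolding eq by (intro sum.reindex_bij_betw bij_betw_prod_prime_powers assms(2) S)
  finally show ?thesis by simp
qed

text \<open>Euler product: absolute summability of each local series permits expanding the finite
  product of infinite sums.\<close>

lemma infsum_prime_support_prod:
  fixes G :: "nat \<Rightarrow> nat \<Rightarrow> 'a :: {banach, real_normed_div_algebra, comm_semiring_1}"
  assumes "finite S" and S: "\<And>l. l \<in> S \<Longrightarrow> prime l"
    and "\<And>l. l \<in> S \<Longrightarrow> G l abs_summable_on UNIV"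
  shows "(\<Sum>\<^sub>\<infinity>n | n > 0 \<and> prime_factors n \<subseteq> S. \<Prod>l\<in>S. G l (multiplicity l n)) =
           (\<Prod>l\<in>S. \<Sum>\<^sub>\<infinity>k. G l k)"
proof -
  have "(\<Prod>l\<in>S. \<Sum>\<^sub>\<infinity>k. G l k) = (\<Sum>\<^sub>\<infinity>g\<in>PiE S (\<lambda>_. UNIV). \<Prod>l\<in>S. G l (g l))"
    using assms by (intro infsum_prod_PiE_abs[symmetric]) auto
  also have "\<dots> = (\<Sum>\<^sub>\<infinity>g\<in>PiE S (\<lambda>_. UNIV). \<Prod>l\<in>S. G l (multiplicity l (\<Prod>l\<in>S. l ^ g l)))"
    using S by (intro infsum_cong prod.cong refl) (simp add: multiplicity_prod_prime_powers[OF assms(1)])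
  also have "\<dots> = (\<Sum>\<^sub>\<infinity>n | n > 0 \<and> prime_factors n \<subseteq> S. \<Prod>l\<in>S. G l (multiplicity l n))"
    using infsum_reindex_bij_betw[OF bij_betw_prod_prime_powers[OF assms(1) S, of "\<lambda>_. UNIV"],
        of "\<lambda>n. \<Prod>l\<in>S. G l (multiplicity l n)"] by simp
  finally show ?thesis by simp
qed

section \<open>Moebius sums of gcd ratios as products over primes\<close>

text \<open>The Moebius function at the \<open>k\<close>-th power of any prime.\<close>

definition moebius_factor :: "nat \<Rightarrow> real" where
  "moebius_factor k = (if k = 0 then 1 else if k = 1 then - 1 else 0)"

lemma moebius_mu_eq_prod:
  assumes "n > 0" "finite S" "\<And>l. l \<in> S \<Longrightarrow> prime l" "prime_factors n \<subseteq> S"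
  shows "moebius_mu n = (\<Prod>l\<in>S. moebius_factor (multiplicity l n))"
proof -
  have "(\<Prod>l\<in>S. moebius_factor (multiplicity l n)) =
          (\<Prod>l\<in>prime_factors n. moebius_factor (multiplicity l n))"
    using assms by (intro prod.mono_neutral_right) (auto simp: prime_factors_multiplicity moebius_factor_def)
  also have "\<dots> = moebius_mu n"
  proof (cases "squarefree n")
    case True
    then have "\<forall>l\<in>prime_factors n. multiplicity l n = 1"
      using assms(1) by (simp add: squarefree_factorial_semiring')
    then show ?thesis
      using True by (simp add: moebius_mu_def moebius_factor_def)
  next
    case False
    then obtain l where l: "l \<in> prime_factors n" "multiplicity l n \<noteq> 1"
      using assms(1) by (auto simp: squarefree_factorial_semiring')
    then have "moebius_factor (multiplicity l n) = 0"
      by (auto simp: moebius_factor_def prime_factors_multiplicity)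
    then show ?thesis
      using False l(1) by (auto simp: moebius_mu_def)
  qed
  finally show ?thesis by simp
qed

lemma multiplicity_gcd_nat:
  fixes m n :: nat
  assumes "prime l" "m > 0" "n > 0"
  shows "multiplicity l (gcd m n) = min (multiplicity l m) (multiplicity l n)"
proof -
  have "count (prime_factorization (gcd m n)) l =
          min (count (prime_factorization m) l) (count (prime_factorization n) l)"
    using assms by (subst prime_factorization_gcd) auto
  then show ?thesis using assms(1) by (simp add: count_prime_factorization_prime)
qed

text \<open>The quotient of \<open>gcd m h\<close> by \<open>m\<close> at a prime power
  \<open>m = l ^ k\<close>, where \<open>c\<close> is the valuation of \<open>h\<close> at
  \<open>l\<close>. It is 1 up to \<open>k = c\<close> and decays geometrically afterwards.\<close>

definition gcd_ratio :: "nat \<Rightarrow> nat \<Rightarrow> nat \<Rightarrow> real" where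
  "gcd_ratio l c k = real l ^ min k c / real l ^ k"

lemma gcd_ratio_eq_prod:
  assumes "m > 0" "h > 0" "finite S" "\<And>l. l \<in> S \<Longrightarrow> prime l" "prime_factors m \<subseteq> S"
  shows "real (gcd m h) / real m = (\<Prod>l\<in>S. gcd_ratio l (multiplicity l h) (multiplicity l m))"
proof -
  have m: "real m = (\<Prod>l\<in>S. real l ^ multiplicity l m)"
    using arg_cong[OF prod_primes_multiplicity[OF assms(1,3-5)], of real] by simp
  have "prime_factors (gcd m h) \<subseteq> S"
    using assms dvd_prime_factors[of m "gcd m h"] by auto
  then have "(\<Prod>l\<in>S. l ^ multiplicity l (gcd m h)) = gcd m h"
    using assms by (intro prod_primes_multiplicity) auto
  then have "real (gcd m h) = (\<Prod>l\<in>S. real l ^ multiplicity l (gcd m h))"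
    by (metis (mono_tags, lifting) of_nat_power of_nat_prod prod.cong)
  also have "\<dots> = (\<Prod>l\<in>S. real l ^ min (multiplicity l m) (multiplicity l h))"
    using assms by (intro prod.cong) (auto simp: multiplicity_gcd_nat)
  finally show ?thesis
    by (simp add: m gcd_ratio_def prod_dividef)
qed

lemma sum_moebius_factor:
  assumes "D > 0"
  shows "(\<Sum>j\<le>D. moebius_factor j * c j) = c 0 - c (1 :: nat)"
proof -
  have "(\<Sum>j\<le>D. moebius_factor j * c j) = (\<Sum>j\<in>{0,1}. moebius_factor j * c j)"
    using assms by (intro sum.mono_neutral_right) (auto simp: moebius_factor_def)
  then show ?thesis by (simp add: moebius_factor_def)
qed

text \<open>For fixed \<open>v\<close> the sum over \<open>u\<close> sees only the local exponents 0
  and 1, which leaves the difference of the ratios at \<open>k\<close> and \<open>Suc k\<close>,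
  with \<open>k\<close> the valuation of \<open>v\<close>. The sum over \<open>v\<close> then
  telescopes, and the ratio at 0 is 1.\<close>

lemma sum_moebius_gcd:
  assumes "d > 0" "e > 0" "h > 0" "prime_factors e \<subseteq> prime_factors d"
  shows "(\<Sum>v | v dvd e. \<Sum>u | u dvd d. moebius_mu u * real (gcd (u * v) h) / real (u * v)) =
         (\<Prod>l\<in>prime_factors d. 1 - gcd_ratio l (multiplicity l h) (Suc (multiplicity l e)))"
proof -
  let ?S = "prime_factors d"
  let ?c = "\<lambda>l. gcd_ratio l (multiplicity l h)"
  have S: "finite ?S" "\<And>l. l \<in> ?S \<Longrightarrow> prime l" by auto
  have "(\<Sum>u | u dvd d. moebius_mu u * real (gcd (u * v) h) / real (u * v)) =
        (\<Prod>l\<in>?S. ?c l (multiplicity l v) - ?c l (Suc (multiplicity l v)))" if v: "v dvd e" for v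
  proof -
    have v0: "v > 0" "prime_factors v \<subseteq> ?S"
      using v assms dvd_prime_factors[of e v] by (auto intro: dvd_pos_nat)
    have "(\<Sum>u | u dvd d. moebius_mu u * real (gcd (u * v) h) / real (u * v)) =
          (\<Sum>u | u dvd d. \<Prod>l\<in>?S. moebius_factor (multiplicity l u) *
              ?c l (multiplicity l u + multiplicity l v))"
    proof (intro sum.cong refl)
      fix u assume "u \<in> {u. u dvd d}"
      then have u: "u > 0" "prime_factors u \<subseteq> ?S"
        using assms dvd_prime_factors[of d u] by (auto intro: dvd_pos_nat)
      have "real (gcd (u * v) h) / real (u * v) = (\<Prod>l\<in>?S. ?c l (multiplicity l (u * v)))"
        using u v0 assms by (intro gcd_ratio_eq_prod) (auto simp: prime_factors_product)
      also have "\<dots> = (\<Prod>l\<in>?S. ?c l (multiplicity l u + multiplicity l v))"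
        using u v0 by (intro prod.cong refl) (simp add: prime_elem_multiplicity_mult_distrib in_prime_factors_imp_prime)
      finally show "moebius_mu u * real (gcd (u * v) h) / real (u * v) = (\<Prod>l\<in>?S. moebius_factor (multiplicity l u) *
              ?c l (multiplicity l u + multiplicity l v))"
        using moebius_mu_eq_prod[OF u(1) S u(2)] by (simp add: prod.distrib flip: times_divide_eq_right)
    qed
    also have "\<dots> = (\<Prod>l\<in>?S. \<Sum>j\<le>multiplicity l d. moebius_factor j * ?c l (j + multiplicity l v))"
      using assms(1) S by (intro sum_divisors_prod) auto
    also have "\<dots> = (\<Prod>l\<in>?S. ?c l (multiplicity l v) - ?c l (Suc (multiplicity l v)))"
      by (intro prod.cong refl, subst sum_moebius_factor) (auto simp: prime_factors_multiplicity)
    finally show ?thesis .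
  qed
  then have "(\<Sum>v | v dvd e. \<Sum>u | u dvd d. moebius_mu u * real (gcd (u * v) h) / real (u * v)) =
      (\<Sum>v | v dvd e. \<Prod>l\<in>?S. ?c l (multiplicity l v) - ?c l (Suc (multiplicity l v)))"
    by (intro sum.cong) auto
  also have "\<dots> = (\<Prod>l\<in>?S. \<Sum>k\<le>multiplicity l e. ?c l k - ?c l (Suc k))"
    using assms S by (intro sum_divisors_prod) auto
  also have "\<dots> = (\<Prod>l\<in>?S. 1 - ?c l (Suc (multiplicity l e)))"
    by (intro prod.cong refl, subst sum_telescope) (auto simp: gcd_ratio_def)
  finally show ?thesis .
qed

section \<open>Lifting the exponent\<close>

lemma power_eq_Suc_mult_geometric:
  fixes x :: nat
  assumes "x > 0"
  shows "x ^ n = Suc ((x - 1) * (\<Sum>i<n. x ^ i))"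
proof (induction n)
  case (Suc n)
  have "x ^ Suc n = x ^ n + (x - 1) * x ^ n"
    using assms by (cases x) auto
  then show ?case
    using Suc by (simp add: algebra_simps)
qed simp

lemma multiplicity_power_minus_one_times:
  fixes x :: nat
  assumes "prime l" "x > 1" "n > 0"
  shows "multiplicity l (x ^ n - 1) = multiplicity l (x - 1) + multiplicity l (\<Sum>i<n. x ^ i)"
proof -
  have "(\<Sum>i<n. x ^ i) > 0"
    using assms by (intro sum_pos) auto
  then have "multiplicity l ((x - 1) * (\<Sum>i<n. x ^ i)) =
      multiplicity l (x - 1) + multiplicity l (\<Sum>i<n. x ^ i)"
    using assms by (intro prime_elem_multiplicity_mult_distrib) auto
  then show ?thesis
    using assms power_eq_Suc_mult_geometric[of x n] by simp
qed

text \<open>Modulo \<open>l\<close> the geometric sum reduces to \<open>n\<close>, so it contributes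
  nothing to the valuation.\<close>

lemma multiplicity_power_minus_one_coprime:
  fixes x :: nat
  assumes "prime l" "x > 1" "[x = 1] (mod l)" "n > 0" "\<not> l dvd n"
  shows "multiplicity l (x ^ n - 1) = multiplicity l (x - 1)"
proof -
  have "[(\<Sum>i<n. x ^ i) = (\<Sum>i<n. 1 ^ i)] (mod l)"
    by (intro cong_sum cong_pow assms)
  then have "\<not> l dvd (\<Sum>i<n. x ^ i)"
    using assms(5) by (simp add: cong_dvd_iff)
  then show ?thesis
    using assms by (simp add: multiplicity_power_minus_one_times not_dvd_imp_multiplicity_0 del: One_nat_def)
qed

text \<open>The geometric sum of \<open>l\<close> terms is congruent to \<open>l\<close> modulo
  \<open>l ^ 2\<close>, so its valuation is exactly 1. For \<open>l = 2\<close> the sum is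
  \<open>1 + x\<close>, whence the congruence modulo 4.\<close>

lemma multiplicity_power_prime_minus_one:
  fixes x :: nat
  assumes "prime l" "x > 1" "[x = 1] (mod l)" "l = 2 \<Longrightarrow> [x = 1] (mod 4)"
  shows "multiplicity l (x ^ l - 1) = Suc (multiplicity l (x - 1))"
proof -
  have "[(\<Sum>i<l. x ^ i) = l] (mod l ^ 2)"
  proof (cases "l = 2")
    case True
    then have "[x = 1] (mod 4)" using assms by simp
    then have "[1 + x = 1 + 1] (mod 4)" by (rule cong_add[OF cong_refl])
    moreover have "{..<2::nat} = {0, 1}" by auto
    ultimately show ?thesis using True by (simp add: cong_def)
  next
    case False
    then have "odd l" using assms(1) by (auto simp: prime_nat_iff)
    \<comment> \<open>Oddness enters through the triangular number: the indices below
      \<open>l\<close> sum to \<open>l * j\<close>, which supplies a second factor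
      \<open>l\<close>.\<close>
    then obtain j where j: "l = 2 * j + 1" by (rule oddE)
    obtain z where z: "x = 1 + l * z"
    proof -
      have "l dvd x - 1" using assms(2,3) cong_altdef_nat by fastforce
      then show ?thesis using assms(2) by (intro that[of "(x - 1) div l"]) simp
    qed
    have drop: "[a + l ^ 2 * b = a] (mod l ^ 2)" for a b :: nat
      by (simp add: cong_def)
    \<comment> \<open>First-order binomial expansion of \<open>(1 + l * z) ^ i\<close>.\<close>
    have "[x ^ i = 1 + i * (l * z)] (mod l ^ 2)" for i
    proof (induction i)
      case (Suc i)
      have "[x ^ Suc i = (1 + l * z) * (1 + i * (l * z))] (mod l ^ 2)"
        unfolding power_Suc z by (intro cong_mult cong_refl) (use Suc z in simp)
      also have "(1 + l * z) * (1 + i * (l * z)) = 1 + Suc i * (l * z) + l ^ 2 * (i * z ^ 2)"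
        by (simp add: algebra_simps power2_eq_square)
      also have "[\<dots> = 1 + Suc i * (l * z)] (mod l ^ 2)"
        by (rule drop)
      finally show ?case .
    qed simp
    then have "[(\<Sum>i<l. x ^ i) = (\<Sum>i<l. 1 + i * (l * z))] (mod l ^ 2)"
      by (intro cong_sum)
    also have "(\<Sum>i<l. 1 + i * (l * z)) = l + (\<Sum>i<l. i) * (l * z)"
      unfolding sum.distrib sum_distrib_right by simp
    also have "(\<Sum>i<l. i) = l * j"
      unfolding j by (induction j) (auto simp: algebra_simps)
    also have "l + l * j * (l * z) = l + l ^ 2 * (j * z)"
      by (simp add: power2_eq_square)
    also have "[\<dots> = l] (mod l ^ 2)"
      by (rule drop)
    finally show ?thesis .
  qed
  \<comment> \<open>Divisibility by \<open>l\<close> and by \<open>l ^ 2\<close> is decided modulo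
    \<open>l ^ 2\<close>, so the sum inherits the valuation of \<open>l\<close>.\<close>
  then have *: "m dvd (\<Sum>i<l. x ^ i) \<longleftrightarrow> m dvd l" if "m dvd l ^ 2" for m
    using that by (intro cong_dvd_iff) (rule cong_dvd_modulus_nat)
  have "multiplicity l (\<Sum>i<l. x ^ i) = 1"
  proof (rule multiplicity_eqI)
    show "l ^ 1 dvd (\<Sum>i<l. x ^ i)" using *[of l] by simp
    have "\<not> l ^ 2 dvd l"
      using power_dvd_imp_le[of l 2 1] prime_gt_1_nat[OF assms(1)] by auto
    then show "\<not> l ^ Suc 1 dvd (\<Sum>i<l. x ^ i)" using *[of "l ^ 2"] by (simp add: numeral_2_eq_2)
  qed
  then show ?thesis
    using multiplicity_power_minus_one_times[OF assms(1,2) prime_gt_0_nat[OF assms(1)]] by simp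
qed

text \<open>Split \<open>n\<close> into a power of \<open>l\<close> and a cofactor prime to
  \<open>l\<close>: each factor \<open>l\<close> in the exponent raises the valuation by 1, and the
  cofactor leaves it unchanged.\<close>

lemma multiplicity_power_minus_one_lifting:
  fixes x :: nat
  assumes "prime l" "x > 1" "[x = 1] (mod l)" "l = 2 \<Longrightarrow> [x = 1] (mod 4)" "n > 0"
  shows "multiplicity l (x ^ n - 1) = multiplicity l (x - 1) + multiplicity l n"
proof -
  have *: "multiplicity l (x ^ l ^ k - 1) = multiplicity l (x - 1) + k" for k
  proof (induction k)
    case (Suc k)
    have "multiplicity l ((x ^ l ^ k) ^ l - 1) = Suc (multiplicity l (x ^ l ^ k - 1))"
    proof (rule multiplicity_power_prime_minus_one)
      show "x ^ l ^ k > 1" using assms by (intro one_less_power) (auto simp: prime_gt_0_nat)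
      show "[x ^ l ^ k = 1] (mod l)" using cong_pow[OF assms(3), of "l ^ k"] by simp
      show "[x ^ l ^ k = 1] (mod 4)" if "l = 2" using cong_pow[OF assms(4)[OF that], of "l ^ k"] by simp
    qed (use assms in auto)
    also have "(x ^ l ^ k) ^ l = x ^ l ^ Suc k" by (simp add: mult.commute flip: power_mult)
    finally show ?case using Suc by simp
  qed simp
  obtain m where m: "n = l ^ multiplicity l n * m" "\<not> l dvd m"
    using multiplicity_decompose'[of n l] assms not_prime_unit by (metis less_irrefl)
  let ?y = "x ^ l ^ multiplicity l n"
  have "multiplicity l (?y ^ m - 1) = multiplicity l (?y - 1)"
  proof (rule multiplicity_power_minus_one_coprime)
    show "?y > 1" using assms by (intro one_less_power) (auto simp: prime_gt_0_nat)
    show "[?y = 1] (mod l)" using cong_pow[OF assms(3), of "l ^ multiplicity l n"] by simp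
    show "m > 0" using m(2) by (intro gr0I) auto
  qed (use assms m in auto)
  then show ?thesis using * m(1) by (metis power_mult)
qed

text \<open>In the exceptional case \<open>x - 1\<close> has 2-adic valuation 1, which odd exponents
  preserve. For even exponents the regular formula applies to \<open>x ^ 2\<close>, which is 1
  modulo 4, and the factorization of \<open>x ^ 2 - 1\<close> brings in
  \<open>x + 1\<close>.\<close>

lemma multiplicity_power_minus_one:
  fixes x :: nat
  assumes "prime l" "x > 1" "[x = 1] (mod l)" "n > 0"
  shows "multiplicity l (x ^ n - 1) =
    (if l = 2 \<and> x mod 4 = 3 then if odd n then 1 else multiplicity 2 (x + 1) + multiplicity 2 n
     else multiplicity l (x - 1) + multiplicity l n)"
proof (cases "l = 2 \<and> x mod 4 = 3")
  case False
  have "[x = 1] (mod 4)" if "l = 2"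
  proof -
    have "odd x" using assms(3) that by (auto simp: cong_def odd_iff_mod_2_eq_one)
    then have "x mod 4 = 1 \<or> x mod 4 = 3" by presburger
    then show ?thesis using False that by (auto simp: cong_def)
  qed
  then show ?thesis
    using multiplicity_power_minus_one_lifting[OF assms(1-3) _ assms(4)] if_not_P[OF False] by metis
next
  case True
  then have "x mod 4 = 3" by simp
  then have four: "2 dvd x - 1" "\<not> 4 dvd x - 1" "odd x" by presburger+
  then have mult1: "multiplicity 2 (x - 1) = 1"
    by (intro multiplicity_eqI) auto
  show ?thesis
  proof (cases "odd n")
    case odd: True
    then show ?thesis
      using multiplicity_power_minus_one_coprime[of 2 x n] True mult1 assms by (simp del: One_nat_def)
  next
    case False
    then obtain m where m: "n = 2 * m" by blast
    have x2: "x ^ 2 > 1" using assms(2) by (intro one_less_power) auto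
    have "x ^ 2 mod 4 = (3 ^ 2) mod 4" using True by (metis power_mod)
    then have "[x ^ 2 = 1] (mod 4)" by (simp add: cong_def)
    then have "multiplicity 2 ((x ^ 2) ^ m - 1) = multiplicity 2 (x ^ 2 - 1) + multiplicity 2 m"
    proof (intro multiplicity_power_minus_one_lifting)
      show "[x ^ 2 = 1] (mod 2)" using \<open>[x ^ 2 = 1] (mod 4)\<close> by (rule cong_dvd_modulus_nat) simp
      show "m > 0" using m assms(4) by simp
    qed (use x2 \<open>[x ^ 2 = 1] (mod 4)\<close> in auto)
    also have "x ^ 2 - 1 = (x - 1) * (x + 1)"
      by (simp add: power2_eq_square algebra_simps diff_mult_distrib)
    also have "multiplicity 2 \<dots> = 1 + multiplicity 2 (x + 1)"
      using assms(2) mult1 by (subst prime_elem_multiplicity_mult_distrib) auto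
    finally have *: "multiplicity 2 ((x ^ 2) ^ m - 1) = 1 + multiplicity 2 (x + 1) + multiplicity 2 m" .
    \<comment> \<open>The valuation 1 of \<open>x - 1\<close> makes up for the factor 2 lost in
      passing from \<open>n\<close> to \<open>m\<close>.\<close>
    have "multiplicity 2 n = Suc (multiplicity 2 m)"
      using m assms(4) multiplicity_times_same[of m 2] by simp
    then show ?thesis using True False * m by (simp add: power_mult)
  qed
qed

section \<open>Positivity of the exponent \<open>h\<close>\<close>

text \<open>
  For a general field, \<open>'a poly\<close> is not an instance of the type classes with a gcd, so coprime
  representatives of a fraction are obtained through Bezout's identity.
\<close>

definition bezout :: "'a::comm_ring_1 \<Rightarrow> 'a \<Rightarrow> bool" where
  "bezout x y \<longleftrightarrow> (\<exists>u v. u * x + v * y = 1)"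

lemma bezout_commute: "bezout x y \<longleftrightarrow> bezout y x"
  unfolding bezout_def by (metis add.commute)

lemma bezout_mult:
  assumes "bezout x y" "bezout x' y"
  shows "bezout (x * x') y"
proof -
  obtain u v u' v' where *: "u * x + v * y = 1" "u' * x' + v' * y = 1"
    using assms unfolding bezout_def by blast
  have "(u * u') * (x * x') + (u * x * v' + v * u' * x' + v * y * v') * y =
          (u * x + v * y) * (u' * x' + v' * y)"
    by (simp add: algebra_simps)
  then show ?thesis unfolding bezout_def * by auto
qed

lemma bezout_power_left: "bezout x y \<Longrightarrow> bezout (x ^ n) y"
proof (induction n)
  case 0
  have "1 * 1 + 0 * y = 1" by simp
  then show ?case unfolding bezout_def power_0 by blast
qed (simp add: bezout_mult)

lemma bezout_power:
  assumes "bezout x y"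
  shows "bezout (x ^ n) (y ^ n)"
proof -
  have "bezout y (x ^ n)" using bezout_power_left[OF assms] by (rule bezout_commute[THEN iffD1])
  then have "bezout (y ^ n) (x ^ n)" by (rule bezout_power_left)
  then show ?thesis by (rule bezout_commute[THEN iffD1])
qed

text \<open>Multiply the Bezout identity by \<open>z\<close>: both summands become divisible by
  \<open>x\<close>.\<close>

lemma bezout_dvd_mult:
  assumes "bezout x y" "x dvd y * z"
  shows "x dvd z"
proof -
  obtain u v where *: "u * x + v * y = 1"
    using assms unfolding bezout_def by blast
  have "z = (u * x + v * y) * z" using * by simp
  also have "\<dots> = x * (u * z) + v * (y * z)" by (simp add: algebra_simps)
  also have "x dvd \<dots>" using assms(2) by (intro dvd_add) auto
  finally show ?thesis .
qed

lemma poly_fract_bezout_cases: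
  fixes b :: "'a::field poly fract"
  obtains x y where "y \<noteq> 0" "b = Fract x y" "bezout x y"
proof -
  obtain x0 y0 where xy0: "b = Fract x0 y0" "y0 \<noteq> 0" by (cases b)
  \<comment> \<open>Nonzero elements of the ideal spanned by numerator and denominator. One of least
    degree is a gcd, since a nonzero remainder would be a member of smaller degree.\<close>
  define I where "I = {e. e \<noteq> 0 \<and> (\<exists>u v. e = u * x0 + v * y0)}"
  have "y0 = 0 * x0 + 1 * y0" by simp
  then have "y0 \<in> I" unfolding I_def using xy0(2) by blast
  then obtain e where e: "e \<in> I" and min: "\<And>e'. e' \<in> I \<Longrightarrow> Polynomial.degree e \<le> Polynomial.degree e'"
    using ex_has_least_nat[of "\<lambda>e. e \<in> I" y0 Polynomial.degree] by blast
  obtain u v where uv: "e = u * x0 + v * y0" and "e \<noteq> 0" using e by (auto simp: I_def)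
  have dvd: "e dvd s * x0 + t * y0" for s t
  proof (rule ccontr)
    assume "\<not> e dvd s * x0 + t * y0"
    then have r: "(s * x0 + t * y0) mod e \<noteq> 0" by (simp add: dvd_eq_mod_eq_0)
    have "(s * x0 + t * y0) mod e = (s * x0 + t * y0) - (s * x0 + t * y0) div e * e"
      by (simp add: minus_div_mult_eq_mod)
    also have "\<dots> = (s - (s * x0 + t * y0) div e * u) * x0 + (t - (s * x0 + t * y0) div e * v) * y0"
      by (subst (2) uv) (simp add: algebra_simps)
    finally have "(s * x0 + t * y0) mod e \<in> I" unfolding I_def using r by blast
    then show False using min Polynomial.degree_mod_less[OF \<open>e \<noteq> 0\<close>, of "s * x0 + t * y0"] r by fastforce
  qed
  obtain x where x: "x0 = e * x" using dvd[of 1 0] by auto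
  obtain y where y: "y0 = e * y" using dvd[of 0 1] by auto
  have "e * (u * x + v * y) = e * 1" using uv by (simp add: x y algebra_simps)
  then have "u * x + v * y = 1" using \<open>e \<noteq> 0\<close> mult_left_cancel by blast
  then have "bezout x y" by (auto simp: bezout_def)
  moreover have "y \<noteq> 0" using xy0(2) y by auto
  moreover have "b = Fract x y" using xy0 \<open>y \<noteq> 0\<close> by (simp add: x y eq_fract)
  ultimately show thesis using that by blast
qed

lemma Fract_power: "y \<noteq> 0 \<Longrightarrow> Fract x y ^ n = Fract (x ^ n) (y ^ n)"
proof (induction n)
  case 0
  show ?case by (simp only: power_0 One_fract_def)
qed simp

text \<open>Write \<open>b\<close> as \<open>x / y\<close> in lowest terms. Then
  \<open>x ^ t\<close> divides the monic numerator and \<open>y ^ t\<close> the monic denominator,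
  so their degrees bound \<open>t\<close> as soon as \<open>x\<close> or \<open>y\<close> is
  nonconstant.\<close>

lemma monic_part_power_bound:
  fixes a :: "'a::field poly fract"
  assumes "a \<noteq> 0" "a \<notin> range const_fract"
  obtains N where "\<And>t b. monic_part a = b ^ t \<Longrightarrow> t \<le> N"
proof -
  obtain f g where fg: "a = Fract f g" "g \<noteq> 0" by (cases a)
  have "f \<noteq> 0" using fg assms(1) by (auto simp: fract_collapse)
  let ?F = "monic_poly f" and ?G = "monic_poly g"
  have bound: "t \<le> Polynomial.degree ?F + Polynomial.degree ?G" if "monic_part a = b ^ t" for b t
  proof -
    obtain x y where xy: "y \<noteq> 0" "b = Fract x y" "bezout x y" by (rule poly_fract_bezout_cases)
    have "Fract ?F ?G = Fract (x ^ t) (y ^ t)"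
      using that fg xy by (simp add: monic_part_Fract Fract_power)
    then have eq: "?F * y ^ t = x ^ t * ?G" using fg xy by (simp add: eq_fract)
    have bez: "bezout (x ^ t) (y ^ t)" "bezout (y ^ t) (x ^ t)"
      using bezout_power[OF xy(3)] bezout_power[OF bezout_commute[THEN iffD1, OF xy(3)]] .
    have "x ^ t dvd ?F"
      by (rule bezout_dvd_mult[OF bez(1)]) (subst mult.commute, simp add: eq)
    then have dx: "t * Polynomial.degree x \<le> Polynomial.degree ?F"
      using dvd_imp_degree_le[of "x ^ t" ?F] \<open>f \<noteq> 0\<close> by (cases "x = 0") (auto simp: Polynomial.degree_power_eq)
    have "y ^ t dvd ?G"
      by (rule bezout_dvd_mult[OF bez(2)]) (simp flip: eq)
    then have dy: "t * Polynomial.degree y \<le> Polynomial.degree ?G"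
      using dvd_imp_degree_le[of "y ^ t" ?G] fg by (simp add: Polynomial.degree_power_eq xy)
    \<comment> \<open>If both were constant, \<open>eq\<close> would make \<open>f\<close> a scalar
      multiple of \<open>g\<close>, and \<open>a\<close> would be a constant.\<close>
    have "Polynomial.degree x > 0 \<or> Polynomial.degree y > 0"
    proof (rule ccontr)
      assume "\<not> ?thesis"
      then obtain r s where "x = [:r:]" "y = [:s:]" by (meson Polynomial.degree_eq_zeroE gr0I)
      then have "?F * [:s ^ t:] = [:r ^ t:] * ?G" using eq by (simp add: poly_const_pow)
      then have *: "smult (s ^ t * inverse (Polynomial.lead_coeff f)) f = smult (r ^ t * inverse (Polynomial.lead_coeff g)) g"
        by (simp add: monic_poly_def mult.commute)
      have "s \<noteq> 0" using xy \<open>y = [:s:]\<close> by auto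
      then have "f = smult (Polynomial.lead_coeff f / s ^ t * (r ^ t * inverse (Polynomial.lead_coeff g))) g"
        using arg_cong[OF *, of "smult (Polynomial.lead_coeff f / s ^ t)"] \<open>f \<noteq> 0\<close> by simp
      then obtain k where "f = smult k g" by blast
      then have "a = const_fract k" using fg by (simp add: const_fract_def eq_fract)
      then show False using assms(2) by blast
    qed
    then have "t \<le> t * Polynomial.degree x + t * Polynomial.degree y" by (cases "Polynomial.degree x") auto
    then show ?thesis using dx dy by simp
  qed
  show thesis by (rule that) (rule bound)
qed

text \<open>\<open>GREATEST\<close> is unspecified on an unbounded predicate, hence the need for the bound above.\<close>

lemma max_exponent_pos:
  fixes a :: "'a::field poly fract"
  assumes "a \<noteq> 0" "a \<notin> range const_fract"
  shows "max_exponent a > 0"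
proof -
  let ?P = "\<lambda>t. t \<ge> 1 \<and> (\<exists>b. b \<noteq> 0 \<and> monic_part a = b ^ t)"
  obtain N where N: "\<And>t b. monic_part a = b ^ t \<Longrightarrow> t \<le> N"
    using monic_part_power_bound[OF assms] by blast
  \<comment> \<open>Otherwise it would equal \<open>0 ^ Suc N\<close>, against the bound
    \<open>N\<close>.\<close>
  have "monic_part a \<noteq> 0"
    using N[of 0 "Suc N"] by (metis N Suc_n_not_le_n zero_power zero_less_Suc)
  then have "?P 1" by auto
  then have "?P (Greatest ?P)"
    by (rule GreatestI_nat[where b = N]) (use N in auto)
  then show ?thesis unfolding max_exponent_def by linarith
qed

section \<open>The local densities\<close>

lemma gcd_infty_pos: "gcd_infty k d > 0"
  unfolding gcd_infty_def by (intro prod_pos) (auto dest: in_prime_factors_imp_prime simp: prime_gt_0_nat)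

lemma multiplicity_gcd_infty:
  "prime l \<Longrightarrow> multiplicity l (gcd_infty k d) = (if l \<in> prime_factors d then multiplicity l k else 0)"
  unfolding gcd_infty_def by (rule multiplicity_prod_prime_powers) auto

lemma prime_factors_gcd_infty: "prime_factors (gcd_infty k d) \<subseteq> prime_factors d"
proof
  fix l assume "l \<in> prime_factors (gcd_infty k d)"
  then have "prime l" "multiplicity l (gcd_infty k d) > 0" by (auto simp: prime_factors_multiplicity)
  then show "l \<in> prime_factors d" using multiplicity_gcd_infty[of l k d] by (metis less_irrefl)
qed

lemma gcd_infty_dvd:
  assumes "k > 0"
  shows "gcd_infty k d dvd k"
proof (rule multiplicity_le_imp_dvd)
  show "gcd_infty k d \<noteq> 0" using gcd_infty_pos[of k d] by simp
qed (simp add: multiplicity_gcd_infty)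

lemma dvd_infty_iff:
  assumes "d > 0"
  shows "dvd_infty w d \<longleftrightarrow> w > 0 \<and> prime_factors w \<subseteq> prime_factors d"
proof
  assume "dvd_infty w d"
  then obtain k where k: "w > 0" "w dvd d ^ k" by (auto simp: dvd_infty_def)
  then have "prime_factors w \<subseteq> prime_factors (d ^ k)"
    using assms by (intro dvd_prime_factors) auto
  also have "\<dots> \<subseteq> prime_factors d"
    using assms by (auto simp: prime_factors_dvd dest: prime_dvd_power)
  finally show "w > 0 \<and> prime_factors w \<subseteq> prime_factors d" using k by simp
next
  assume w: "w > 0 \<and> prime_factors w \<subseteq> prime_factors d"
  \<comment> \<open>The crude exponent \<open>w\<close> suffices: every valuation of
    \<open>w\<close> is below \<open>w\<close>, and every prime of \<open>w\<close> divides
    \<open>d\<close>.\<close>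
  have "w dvd d ^ w"
  proof (rule multiplicity_le_imp_dvd)
    fix l :: nat assume l: "prime l"
    show "multiplicity l w \<le> multiplicity l (d ^ w)"
    proof (cases "l \<in> prime_factors w")
      case True
      then have "multiplicity l d \<ge> 1" using w by (auto simp: prime_factors_multiplicity)
      moreover have "multiplicity l w \<le> w"
      proof -
        have "multiplicity l w < l ^ multiplicity l w" using prime_gt_1_nat[OF l] by (simp add: power_gt_expt)
        also have "\<dots> \<le> w" using w multiplicity_dvd by (intro dvd_imp_le) auto
        finally show ?thesis by simp
      qed
      ultimately have "multiplicity l w * 1 \<le> w * multiplicity l d" by (intro mult_le_mono) auto
      then show ?thesis using assms l by (simp add: prime_elem_multiplicity_power_distrib)
    qed (use l in \<open>simp add: prime_factors_multiplicity\<close>)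
  qed (use w in auto)
  then show "dvd_infty w d" using w by (auto simp: dvd_infty_def)
qed

lemma ord_dvd_iff_dvd_power_minus_one:
  fixes m q :: nat
  assumes "q > 0"
  shows "ord m q dvd n \<longleftrightarrow> m dvd q ^ n - 1"
proof -
  have "1 \<le> q ^ n" using assms by simp
  then show ?thesis using ord_divides[of q n m] cong_altdef_nat[of 1 "q ^ n" m] by blast
qed

text \<open>The subtraction of natural numbers is exact because \<open>d\<close> divides
  \<open>q ^ n - 1\<close>.\<close>

lemma multiplicity_e_part:
  assumes "q > 1" "d > 0" "coprime d q" "ord d q dvd n" "n > 0" "l \<in> prime_factors d"
  shows "multiplicity l (e_part q d n) = multiplicity l (q ^ n - 1) - multiplicity l d"
proof -
  have "d dvd q ^ n - 1" using assms ord_dvd_iff_dvd_power_minus_one by simp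
  then have "q ^ n - 1 = d * ((q ^ n - 1) div d)" by simp
  moreover have "q ^ n - 1 > 0" using one_less_power[OF assms(1,5)] by simp
  ultimately have "multiplicity l (q ^ n - 1) = multiplicity l d + multiplicity l ((q ^ n - 1) div d)"
    using assms(2,6) by (metis in_prime_factors_imp_prime mult_is_0 neq0_conv prime_elem_multiplicity_mult_distrib prime_imp_prime_elem)
  then show ?thesis
    unfolding e_part_def using assms by (simp add: multiplicity_gcd_infty in_prime_factors_imp_prime)
qed

lemma delta_w_eq_prod:
  fixes a :: "'a::{field, finite} poly fract"
  defines "q \<equiv> CARD('a)"
  assumes "q > 1" "d > 0" "coprime d q" "max_exponent a > 0" "w > 0"
    and deg: "\<And>u v. u dvd d \<Longrightarrow> dvd_infty v d \<Longrightarrow> constant_degree a d u v = ord (d * v) q"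
  shows "delta_w a d w = (\<Prod>l\<in>prime_factors d.
           1 - gcd_ratio l (multiplicity l (max_exponent a))
                 (Suc (multiplicity l (q ^ (ord d q * w) - 1) - multiplicity l d)))"
proof -
  let ?n = "ord d q * w" and ?h = "max_exponent a"
  let ?e = "e_part q d ?n"
  have n: "?n > 0" using assms by simp
  have d_dvd: "d dvd q ^ ?n - 1" using assms ord_dvd_iff_dvd_power_minus_one[of q d ?n] by simp
  have pos: "q ^ ?n - 1 > 0" using one_less_power[OF assms(2) n] by simp
  then have "(q ^ ?n - 1) div d > 0" using d_dvd by (metis dvd_div_eq_0_iff neq0_conv)
  then have e_dvd: "?e dvd (q ^ ?n - 1) div d" unfolding e_part_def by (rule gcd_infty_dvd)
  have e: "?e > 0" "prime_factors ?e \<subseteq> prime_factors d"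
    unfolding e_part_def by (rule gcd_infty_pos, rule prime_factors_gcd_infty)
  have "constant_degree a d u v dvd ?n" if "u dvd d" "v dvd ?e" for u v
  proof -
    have "v > 0" "prime_factors v \<subseteq> prime_factors d"
      using that e dvd_prime_factors[of ?e v] by (auto intro: dvd_pos_nat)
    then have "dvd_infty v d" using assms(3) by (simp add: dvd_infty_iff)
    moreover have "d * v dvd d * ((q ^ ?n - 1) div d)"
      using that(2) e_dvd by (intro mult_dvd_mono) (auto intro: dvd_trans)
    then have "ord (d * v) q dvd ?n"
      using ord_dvd_iff_dvd_power_minus_one[of q "d * v" ?n] assms(2)
      unfolding dvd_mult_div_cancel[OF d_dvd] by linarith
    ultimately show ?thesis using deg that(1) by simp
  qed
  then have "delta_w a d w =
      (\<Sum>v | v dvd ?e. \<Sum>u | u dvd d. moebius_mu u * real (gcd (u * v) ?h) / real (u * v))"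
    unfolding delta_w_def Let_def q_def[symmetric] by (intro sum.cong refl) simp
  also have "\<dots> = (\<Prod>l\<in>prime_factors d. 1 - gcd_ratio l (multiplicity l ?h) (Suc (multiplicity l ?e)))"
    by (rule sum_moebius_gcd[OF assms(3) e(1) assms(5) e(2)])
  also have "\<dots> = (\<Prod>l\<in>prime_factors d.
           1 - gcd_ratio l (multiplicity l ?h) (Suc (multiplicity l (q ^ ?n - 1) - multiplicity l d)))"
    using multiplicity_e_part[OF assms(2-4) _ n] by (intro prod.cong refl) simp
  finally show ?thesis .
qed

text \<open>If \<open>d * gcd_infty h d\<close> divides \<open>N\<close>, every minimum in
  \<open>gcd_ratio\<close> is the valuation of \<open>h\<close>. Otherwise the divisibility fails at
  some prime of \<open>d\<close>; there the minimum is the other argument, the ratio is 1, and the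
  whole product vanishes.\<close>

lemma prod_gcd_ratio_eq:
  fixes d h N :: nat
  assumes "d > 0" "h > 0" "d dvd N" "N > 0"
  shows "(\<Prod>l\<in>prime_factors d.
            1 - gcd_ratio l (multiplicity l h) (Suc (multiplicity l N - multiplicity l d))) =
         (if d * gcd_infty h d dvd N
          then \<Prod>l\<in>prime_factors d. 1 - real l ^ multiplicity l (d * h) / real l ^ Suc (multiplicity l N)
          else 0)"
proof -
  let ?D = "d * gcd_infty h d"
  have D: "?D > 0" using assms gcd_infty_pos by simp
  have mD: "multiplicity l ?D = multiplicity l d + (if l \<in> prime_factors d then multiplicity l h else 0)"
    if "prime l" for l
    using that assms gcd_infty_pos[of h d]
    by (simp add: prime_elem_multiplicity_mult_distrib multiplicity_gcd_infty)
  have le: "multiplicity l d \<le> multiplicity l N" for l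
    using assms by (intro dvd_imp_multiplicity_le) auto
  show ?thesis
  proof (cases "?D dvd N")
    case True
    have "gcd_ratio l (multiplicity l h) (Suc (multiplicity l N - multiplicity l d)) =
            real l ^ multiplicity l (d * h) / real l ^ Suc (multiplicity l N)"
      if l: "l \<in> prime_factors d" for l
    proof -
      have "prime l" using l by auto
      have "multiplicity l ?D \<le> multiplicity l N"
        using True assms by (intro dvd_imp_multiplicity_le) auto
      then have *: "multiplicity l d + multiplicity l h \<le> multiplicity l N"
        using mD[OF \<open>prime l\<close>] l by simp
      have "real l ^ multiplicity l (d * h) / real l ^ Suc (multiplicity l N) =
          (real l ^ multiplicity l d * real l ^ multiplicity l h) /
          (real l ^ multiplicity l d * real l ^ (Suc (multiplicity l N - multiplicity l d)))"
        using assms \<open>prime l\<close> * by (simp add: prime_elem_multiplicity_mult_distrib flip: power_add)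
      also have "\<dots> = gcd_ratio l (multiplicity l h) (Suc (multiplicity l N - multiplicity l d))"
        using * prime_gt_0_nat[OF \<open>prime l\<close>] by (simp add: gcd_ratio_def min_absorb2)
      finally show ?thesis by simp
    qed
    then show ?thesis using True by simp
  next
    case False
    have "\<exists>l. prime l \<and> \<not> multiplicity l ?D \<le> multiplicity l N"
    proof (rule ccontr)
      assume "\<not> ?thesis"
      then have "?D dvd N" using D by (intro multiplicity_le_imp_dvd) auto
      then show False using False by contradiction
    qed
    then obtain l where l: "prime l" "\<not> multiplicity l ?D \<le> multiplicity l N" by blast
    then have ld: "l \<in> prime_factors d" using mD[of l] le[of l] by (auto split: if_splits)
    then have "multiplicity l N < multiplicity l d + multiplicity l h" using l mD[of l] by simp
    then have "Suc (multiplicity l N - multiplicity l d) \<le> multiplicity l h" using le[of l] by simp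
    then have "gcd_ratio l (multiplicity l h) (Suc (multiplicity l N - multiplicity l d)) = 1"
      using prime_gt_0_nat[OF l(1)] by (simp add: gcd_ratio_def min_absorb1 del: power_Suc)
    then have "(\<Prod>l\<in>prime_factors d.
            1 - gcd_ratio l (multiplicity l h) (Suc (multiplicity l N - multiplicity l d))) = 0"
      using ld by (intro prod_zero) auto
    then show ?thesis using False by simp
  qed
qed

section \<open>The sum over \<open>w\<close> and its Euler factors\<close>

lemma infsum_dvd_infty_multiples:
  fixes g :: "nat \<Rightarrow> real"
  assumes "d > 0" "dvd_infty m d" and "\<And>w. dvd_infty w d \<Longrightarrow> \<not> m dvd w \<Longrightarrow> g w = 0"
  shows "infsum g {w. dvd_infty w d} = (\<Sum>\<^sub>\<infinity>w | dvd_infty w d. g (m * w))"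
proof -
  have m: "m > 0" using assms(2) by (simp add: dvd_infty_def)
  \<comment> \<open>The primes of \<open>m\<close> already divide \<open>d\<close>, so
    multiplication by \<open>m\<close> neither leaves nor enters the index set.\<close>
  have iff: "dvd_infty (m * w) d \<longleftrightarrow> dvd_infty w d" for w
    using assms m by (cases "w = 0") (auto simp: dvd_infty_iff prime_factors_product)
  have "infsum g {w. dvd_infty w d} = infsum g ((*) m ` {w. dvd_infty w d})"
  proof (rule infsum_cong_neutral)
    fix w assume "w \<in> {w. dvd_infty w d} - (*) m ` {w. dvd_infty w d}"
    then show "g w = 0" using assms(3)[of w] iff by (auto elim!: dvdE)
  next
    fix w assume "w \<in> (*) m ` {w. dvd_infty w d} - {w. dvd_infty w d}"
    then show "g w = 0" using iff by auto
  qed simp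
  also have "\<dots> = infsum (g \<circ> (*) m) {w. dvd_infty w d}"
    using m by (intro infsum_reindex) (auto simp: inj_on_def)
  finally show ?thesis by (simp add: o_def)
qed

text \<open>The number \<open>m\<close> is the order of \<open>q ^ ord d q\<close> modulo
  \<open>D\<close>, so it divides any exponent that makes this power 1 modulo \<open>D\<close>. One
  such exponent is \<open>D\<close> itself.\<close>

lemma ord_quotient_dvd_infty:
  fixes d D q :: nat
  assumes "q > 1" "d > 0" "D > 0" "coprime d q" "prime_factors D \<subseteq> prime_factors d" "ord D q = ord d q * m"
  shows "dvd_infty m d"
proof -
  let ?x = "q ^ ord d q"
  have f: "ord d q > 0" using assms by simp
  have x: "?x > 1" using assms(1) f by (rule one_less_power)
  \<comment> \<open>The exponent \<open>D\<close> is far from optimal, but it has only prime factors of \<open>d\<close>.\<close>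
  have "D dvd ?x ^ D - 1"
  proof (rule multiplicity_le_imp_dvd)
    fix l :: nat assume l: "prime l"
    show "multiplicity l D \<le> multiplicity l (?x ^ D - 1)"
    proof (cases "l \<in> prime_factors D")
      case True
      then have "l dvd d" using assms(5) by auto
      then have "[?x = 1] (mod l)" using ord cong_dvd_modulus_nat by blast
      \<comment> \<open>This covers the branch of the lifting formula for odd exponents, where the
        valuation of \<open>?x ^ D - 1\<close> is only 1.\<close>
      moreover have "multiplicity l D = 0" if "l = 2" "odd D"
        using that by (simp add: not_dvd_imp_multiplicity_0)
      ultimately show ?thesis
        using multiplicity_power_minus_one[OF l x _ assms(3)] by (auto split: if_splits)
    qed (use l in \<open>simp add: prime_factors_multiplicity\<close>)
  qed (use assms in auto)
  then have "ord d q * m dvd ord d q * D"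
    using assms by (metis ord_dvd_iff_dvd_power_minus_one power_mult less_trans zero_less_one)
  then have "m dvd D" using f by simp
  then have "m > 0" "prime_factors m \<subseteq> prime_factors d"
    using assms dvd_prime_factors[of D m] by (auto intro: dvd_pos_nat)
  then show ?thesis using assms(2) by (simp add: dvd_infty_iff)
qed

text \<open>The correction \<open>c\<close> at index 0 accommodates the irregular first term of the
  exceptional 2-adic series.\<close>

lemma infsum_two_geometric:
  fixes a b c x y :: real
  assumes "norm x < 1" "norm y < 1"
  defines "f \<equiv> \<lambda>k::nat. (if k = 0 then c else 0) + (a * x ^ k + b * y ^ k)"
  shows "f abs_summable_on UNIV" and "infsum f UNIV = c + (a / (1 - x) + b / (1 - y))"
proof -
  have "(\<lambda>k::nat. if k = 0 then c else 0) sums c"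
    using sums_If_finite_set[of "{0::nat}" "\<lambda>_. c"] by simp
  moreover have "(\<lambda>k. a * x ^ k + b * y ^ k) sums (a * (1 / (1 - x)) + b * (1 / (1 - y)))"
    by (intro sums_add[OF sums_mult[OF geometric_sums] sums_mult[OF geometric_sums]] assms)
  ultimately have sums: "f sums (c + (a / (1 - x) + b / (1 - y)))"
    unfolding f_def by (auto intro: sums_add)
  have "summable (\<lambda>k. norm (if k = 0 then c else 0) + (norm a * norm x ^ k + norm b * norm y ^ k))"
    using sums_If_finite_set[of "{0::nat}" "\<lambda>_. norm c"] assms
    by (intro summable_add summable_mult summable_geometric)
       (auto intro!: sums_summable cong: if_cong simp: if_distrib)
  then have summable: "summable (\<lambda>k. norm (f k))"
  proof (rule summable_comparison_test'[where N = 0])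
    fix k :: nat
    have "norm (f k) \<le> norm (if k = 0 then c else 0) + norm (a * x ^ k + b * y ^ k)"
      unfolding f_def by (rule norm_triangle_ineq)
    also have "norm (a * x ^ k + b * y ^ k) \<le> norm (a * x ^ k) + norm (b * y ^ k)"
      by (rule norm_triangle_ineq)
    finally show "norm (norm (f k)) \<le> norm (if k = 0 then c else 0) + (norm a * norm x ^ k + norm b * norm y ^ k)"
      by (simp add: norm_mult norm_power abs_mult power_abs)
  qed
  show "f abs_summable_on UNIV"
    using norm_summable_imp_summable_on[of "\<lambda>k. norm (f k)"] summable by simp
  show "infsum f UNIV = c + (a / (1 - x) + b / (1 - y))"
    using norm_summable_imp_has_sum[OF summable sums] by (rule infsumI)
qed

text \<open>
  The exponent in \<open>euler_term\<close> is the valuation of \<open>Q\<^bsup>w\<^esup> - 1\<close> at \<open>l\<close> for any \<open>w\<close> of valuation \<open>k\<close>.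
\<close>

definition euler_term :: "nat \<Rightarrow> nat \<Rightarrow> nat \<Rightarrow> nat \<Rightarrow> real" where
  "euler_term l A Q k = (1 - real l ^ A / real l ^ Suc
     (if l = 2 \<and> Q mod 4 = 3 then if k = 0 then 1 else multiplicity 2 (Q + 1) + k
      else multiplicity l (Q - 1) + k)) / real l ^ k"

text \<open>The series splits into geometric series of ratios \<open>1 / l\<close> and
  \<open>1 / l ^ 2\<close>. The factor \<open>1 - 1 / l\<close>, which comes from
  \<open>totient d / d\<close>, normalizes the first to 1 and leaves \<open>l + 1\<close> in the
  denominator of the second.\<close>

lemma euler_term_regular:
  assumes "prime l" "\<not> (l = 2 \<and> Q mod 4 = 3)"
  shows "euler_term l A Q abs_summable_on UNIV"
    and "(1 - 1 / real l) * infsum (euler_term l A Q) UNIV =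
           1 - real l ^ A / ((real l + 1) * real l ^ multiplicity l (Q - 1))"
proof -
  let ?B = "multiplicity l (Q - 1)"
  have l: "real l > 1" using prime_gt_1_nat[OF assms(1)] by simp
  then have l2: "real l ^ 2 > 1" by (intro one_less_power) auto
  let ?b = "- (real l ^ A / real l ^ Suc ?B)"
  have eq: "euler_term l A Q = (\<lambda>k. (if k = 0 then 0 else 0) + (1 * (1 / real l) ^ k + ?b * (1 / real l ^ 2) ^ k))"
    unfolding euler_term_def if_not_P[OF assms(2)] using l
    by (simp add: fun_eq_iff field_simps power_add power2_eq_square power_mult_distrib)
  have norms: "norm (1 / real l) < 1" "norm (1 / real l ^ 2) < 1"
    using l l2 by (simp_all add: divide_less_eq)
  show "euler_term l A Q abs_summable_on UNIV"
    unfolding eq by (rule infsum_two_geometric(1)[OF norms])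
  have "infsum (euler_term l A Q) UNIV = 0 + (1 / (1 - 1 / real l) + ?b / (1 - 1 / real l ^ 2))"
    unfolding eq by (rule infsum_two_geometric(2)[OF norms])
  moreover have "1 - 1 / real l ^ 2 = (1 - 1 / real l) * ((real l + 1) / real l)"
    using l by (simp add: field_simps power2_eq_square)
  \<comment> \<open>Applied with \<open>x = 1 - 1 / l\<close>, \<open>y = l + 1\<close> and
    \<open>z = l\<close>.\<close>
  moreover have "x * (0 + (1 / x + b / (x * (y / z)))) = 1 + b * (z / y)" if "x \<noteq> 0" for x y z b :: real
    using that by (simp add: distrib_left)
  moreover have "1 - 1 / real l \<noteq> 0" using l by simp
  ultimately have "(1 - 1 / real l) * infsum (euler_term l A Q) UNIV = 1 + ?b * (real l / (real l + 1))"
    by presburger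
  also have "real l ^ A / real l ^ Suc ?B * (real l / (real l + 1)) =
      (real l * real l ^ A) / (real l * ((real l + 1) * real l ^ ?B))"
    by (simp add: ac_simps)
  then have "1 + ?b * (real l / (real l + 1)) = 1 - real l ^ A / ((real l + 1) * real l ^ ?B)"
    using l by (subst (asm) mult_divide_mult_cancel_left) auto
  finally show "(1 - 1 / real l) * infsum (euler_term l A Q) UNIV =
      1 - real l ^ A / ((real l + 1) * real l ^ ?B)" .
qed

text \<open>The exponent \<open>A\<close> is 1 here because the exceptional case forces
  \<open>d * h\<close> to have 2-adic valuation 1. The factor \<open>1 / 3\<close> is the regular
  quotient with both valuations equal to 1, and the bracket is \<open>C\<close>.\<close>

lemma euler_term_exceptional:
  assumes "Q mod 4 = 3"
  shows "euler_term 2 1 Q abs_summable_on UNIV"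
    and "(1 - 1 / 2) * infsum (euler_term 2 1 Q) UNIV =
           1 - 1 / 3 * (3 / 4 + 1 / 2 ^ Suc (multiplicity 2 (Q + 1)))"
proof -
  let ?b = "- (1 / 2 ^ multiplicity 2 (Q + 1)) :: real"
  \<comment> \<open>At \<open>k = 0\<close> the true term is \<open>1 / 2\<close>, while the
    geometric pattern gives \<open>1 + ?b\<close>; the correction is the difference.\<close>
  have eq: "euler_term 2 1 Q = (\<lambda>k. (if k = 0 then - ?b - 1 / 2 else 0) + (1 * (1 / 2) ^ k + ?b * (1 / 4) ^ k))"
  proof
    fix k
    have "(4::real) ^ k = 2 ^ k * 2 ^ k" by (simp flip: power_mult_distrib)
    then show "euler_term 2 1 Q k = (if k = 0 then - ?b - 1 / 2 else 0) + (1 * (1 / 2) ^ k + ?b * (1 / 4) ^ k)"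
      using assms by (auto simp: euler_term_def field_simps power_add)
  qed
  have norms: "norm (1 / 2 :: real) < 1" "norm (1 / 4 :: real) < 1" by auto
  show "euler_term 2 1 Q abs_summable_on UNIV"
    unfolding eq by (rule infsum_two_geometric(1)[OF norms])
  have "infsum (euler_term 2 1 Q) UNIV = (- ?b - 1 / 2) + (1 / (1 - 1 / 2) + ?b / (1 - 1 / 4))"
    unfolding eq by (rule infsum_two_geometric(2)[OF norms])
  moreover have "1 / 2 ^ Suc (multiplicity 2 (Q + 1)) = - ?b / 2" by simp
  ultimately show "(1 - 1 / 2) * infsum (euler_term 2 1 Q) UNIV =
           1 - 1 / 3 * (3 / 4 + 1 / 2 ^ Suc (multiplicity 2 (Q + 1)))"
    by (simp only:) (simp add: algebra_simps)
qed

lemma infsum_inverse_prod_euler_terms: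
  fixes d Q :: nat and A :: "nat \<Rightarrow> nat"
  assumes "d > 0" "Q > 1" and cong: "\<And>l. l \<in> prime_factors d \<Longrightarrow> [Q = 1] (mod l)"
    and summable: "\<And>l. l \<in> prime_factors d \<Longrightarrow> euler_term l (A l) Q abs_summable_on UNIV"
  shows "(\<Sum>\<^sub>\<infinity>w | dvd_infty w d.
            (\<Prod>l\<in>prime_factors d. 1 - real l ^ A l / real l ^ Suc (multiplicity l (Q ^ w - 1))) / real w) =
         (\<Prod>l\<in>prime_factors d. \<Sum>\<^sub>\<infinity>k. euler_term l (A l) Q k)"
proof -
  have "(\<Prod>l\<in>prime_factors d. 1 - real l ^ A l / real l ^ Suc (multiplicity l (Q ^ w - 1))) / real w =
          (\<Prod>l\<in>prime_factors d. euler_term l (A l) Q (multiplicity l w))"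
    if w: "w > 0" "prime_factors w \<subseteq> prime_factors d" for w
  proof -
    have "real w = (\<Prod>l\<in>prime_factors d. real l ^ multiplicity l w)"
      using arg_cong[OF prod_primes_multiplicity[of w "prime_factors d"], of real] w
      by (simp add: in_prime_factors_imp_prime)
    moreover have "euler_term l (A l) Q (multiplicity l w) =
        (1 - real l ^ A l / real l ^ Suc (multiplicity l (Q ^ w - 1))) / real l ^ multiplicity l w"
      if l: "l \<in> prime_factors d" for l
    proof -
      \<comment> \<open>Matches the case split of the lifting formula on the parity of
        \<open>w\<close> with that of \<open>euler_term\<close> on \<open>k = 0\<close>.\<close>
      have "odd w \<longleftrightarrow> multiplicity 2 w = 0"
        using w(1) by (simp add: prime_elem_multiplicity_eq_zero_iff)
      then show ?thesis
        using multiplicity_power_minus_one[OF in_prime_factors_imp_prime[OF l] assms(2) cong[OF l] w(1)]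
        by (auto simp: euler_term_def)
    qed
    ultimately show ?thesis by (simp add: prod_dividef)
  qed
  then have "(\<Sum>\<^sub>\<infinity>w | dvd_infty w d.
            (\<Prod>l\<in>prime_factors d. 1 - real l ^ A l / real l ^ Suc (multiplicity l (Q ^ w - 1))) / real w) =
     (\<Sum>\<^sub>\<infinity>w | w > 0 \<and> prime_factors w \<subseteq> prime_factors d.
         \<Prod>l\<in>prime_factors d. euler_term l (A l) Q (multiplicity l w))"
    using assms(1) by (intro infsum_cong_neutral) (auto simp: dvd_infty_iff)
  also have "\<dots> = (\<Prod>l\<in>prime_factors d. \<Sum>\<^sub>\<infinity>k. euler_term l (A l) Q k)"
    by (rule infsum_prime_support_prod) (use summable in auto)
  finally show ?thesis .
qed

section \<open>Assembly of the closed formula\<close>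

theorem theorem8p2:
  fixes a :: "'a::{field, finite} poly fract"
    and p q d h fbar :: nat and C :: real
  assumes "prime p"
    and "\<exists>k\<ge>1. q = p ^ k"
    and "CARD('a) = q"
    and "d \<ge> 2"
    and "\<not> p dvd d"
    and "a \<noteq> 0"
    and "a \<notin> range const_fract"
    and "h = max_exponent a"
    and "fbar = ord (d * gcd_infty h d) q"
    and "C = 3 / 4 + 2 powi (- int (multiplicity 2 (q ^ fbar + 1)) - 1)"
    and "\<And>u v. u dvd d \<Longrightarrow> dvd_infty v d \<Longrightarrow> constant_degree a d u v = ord (d * v) q"
  shows "delta_q a d =
    1 / real fbar *
    (\<Prod>l\<in>prime_factors d.
       1 - real (l ^ multiplicity l (d * h)) * C ^ (of_bool (l = 2) * of_bool (prop_P q d)) /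
           (real (l + 1) * real (l ^ multiplicity l (q ^ fbar - 1))))"
proof -
  define f where "f = ord d q"
  define D where "D = d * gcd_infty h d"
  define Q where "Q = q ^ fbar"
  define A where "A = (\<lambda>l. multiplicity l (d * h))"
  let ?S = "prime_factors d"
  have d: "d > 0" using assms(4) by simp
  have h: "h > 0" using max_exponent_pos[OF assms(6,7)] assms(8) by simp
  obtain k where k: "k \<ge> 1" "q = p ^ k" using assms(2) by blast
  have q: "q > 1" using k prime_gt_1_nat[OF assms(1)] one_less_power[of p k] by simp
  have "coprime p d" using assms(1,5) by (simp add: prime_imp_coprime)
  then have cop: "coprime d q" by (simp add: k coprime_commute)
  have D: "D > 0" using d gcd_infty_pos[of h d] by (simp add: D_def)
  \<comment> \<open>Passing from \<open>d\<close> to \<open>D\<close> adds no primes, so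
    \<open>D\<close> stays coprime to \<open>q\<close> and \<open>fbar\<close> is a genuine positive
    order.\<close>
  have D_primes: "prime_factors D = ?S"
    using prime_factors_product[of d "gcd_infty h d"] d gcd_infty_pos[of h d]
      prime_factors_gcd_infty[of h d] unfolding D_def by blast
  have "\<not> p dvd D"
    using D D_primes assms(1,5) d prime_factors_dvd[of D] prime_factors_dvd[of d] by auto
  then have "coprime p D" using assms(1) by (simp add: prime_imp_coprime)
  then have copD: "coprime D q" by (simp add: k coprime_commute)
  have f: "f > 0" using cop by (simp add: f_def)
  have fbar: "fbar > 0" using copD by (simp add: assms(9) D_def)
  have Q: "Q > 1" unfolding Q_def using q fbar by (rule one_less_power)
  have D_dvd: "D dvd q ^ n - 1 \<longleftrightarrow> fbar dvd n" for n
    using ord_dvd_iff_dvd_power_minus_one[of q D n] q unfolding assms(9) D_def by simp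
  have D_Q: "D dvd Q - 1" using D_dvd[of fbar] by (simp add: Q_def)
  then have d_Q: "d dvd Q - 1" by (auto simp: D_def dest: dvd_mult_left)
  then have "f dvd fbar" using ord_dvd_iff_dvd_power_minus_one[of q d fbar] q by (simp add: f_def Q_def)
  \<comment> \<open>Since \<open>fbar = f * m\<close>, the condition \<open>fbar dvd f * w\<close>
    amounts to \<open>m dvd w\<close>.\<close>
  then obtain m where m: "fbar = f * m" by blast
  then have m_pos: "m > 0" using fbar by simp
  have m_infty: "dvd_infty m d"
    using m D_primes by (intro ord_quotient_dvd_infty[OF q d D cop]) (simp_all add: assms(9) D_def f_def)
  have cong: "[Q = 1] (mod l)" if "l \<in> ?S" for l
  proof -
    have "l dvd Q - 1" using that d_Q in_prime_factors_imp_dvd dvd_trans by blast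
    then show ?thesis using Q by (simp add: cong_altdef_nat)
  qed
  have delta: "delta_w a d w = (if fbar dvd f * w
      then \<Prod>l\<in>?S. 1 - real l ^ A l / real l ^ Suc (multiplicity l (q ^ (f * w) - 1)) else 0)"
    if w: "dvd_infty w d" for w
  proof -
    have w0: "w > 0" using w by (simp add: dvd_infty_def)
    have "delta_w a d w = (\<Prod>l\<in>?S. 1 - gcd_ratio l (multiplicity l h)
            (Suc (multiplicity l (q ^ (f * w) - 1) - multiplicity l d)))"
      using delta_w_eq_prod[of d a w] assms(3,8,11) q d cop h w0 by (simp add: f_def)
    also have "\<dots> = (if fbar dvd f * w
      then \<Prod>l\<in>?S. 1 - real l ^ A l / real l ^ Suc (multiplicity l (q ^ (f * w) - 1)) else 0)"
    proof (subst prod_gcd_ratio_eq)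
      show "d dvd q ^ (f * w) - 1"
        using ord_dvd_iff_dvd_power_minus_one[of q d "f * w"] q by (simp add: f_def)
      show "q ^ (f * w) - 1 > 0" using one_less_power[OF q, of "f * w"] f w0 by simp
    qed (use d h D_dvd in \<open>simp_all add: D_def A_def\<close>)
    finally show ?thesis .
  qed
  \<comment> \<open>As \<open>D\<close> divides \<open>Q - 1\<close>, whose 2-adic valuation is 1,
    and \<open>d\<close> is even, the prime 2 occurs exactly once in \<open>d * h\<close>.\<close>
  have even_case: "l = 2" "A l = 1" "multiplicity l (Q - 1) = 1" "prop_P q d"
    if l: "l \<in> ?S" and ex: "l = 2 \<and> Q mod 4 = 3" for l
  proof -
    show "l = 2" using ex by simp
    have Q4: "\<not> 4 dvd Q - 1" "2 dvd Q - 1" using ex by presburger+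
    then show mQ: "multiplicity l (Q - 1) = 1"
      using ex by (intro multiplicity_eqI) auto
    have "multiplicity 2 D = multiplicity 2 d + multiplicity 2 h"
      using l ex d gcd_infty_pos[of h d] unfolding D_def
      by (simp add: prime_elem_multiplicity_mult_distrib multiplicity_gcd_infty)
    then have "A l = multiplicity 2 D"
      using ex d h by (simp add: A_def prime_elem_multiplicity_mult_distrib)
    also have "\<dots> \<le> multiplicity 2 (Q - 1)" using D_Q Q by (intro dvd_imp_multiplicity_le) auto
    finally have "A l \<le> 1" using mQ ex by simp
    moreover have "A l \<ge> multiplicity 2 d" using d h ex by (simp add: A_def prime_elem_multiplicity_mult_distrib)
    moreover have "multiplicity 2 d > 0" using l ex by (simp add: prime_factors_multiplicity)
    ultimately show "A l = 1" by simp
    have "\<not> 4 dvd d" using Q4 d_Q dvd_trans by blast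
    moreover have "2 dvd d" using l ex by auto
    \<comment> \<open>For even \<open>fbar\<close> the odd number \<open>Q\<close> would be a
      square, hence 1 modulo 4.\<close>
    moreover have odd: "odd fbar"
    proof
      assume "even fbar"
      then obtain j where j: "fbar = 2 * j" by blast
      have sq: "Q = q ^ j * q ^ j" by (simp add: Q_def j mult_2 power_add)
      have "odd Q" using ex by presburger
      then have "odd (q ^ j)" unfolding sq by simp
      then have "(q ^ j) mod 4 = 1 \<or> (q ^ j) mod 4 = 3" by presburger
      then have "(q ^ j * q ^ j) mod 4 = 1" by (auto simp: mod_mult_eq[symmetric, of "q ^ j" "q ^ j" 4])
      then show False using ex sq by simp
    qed
    moreover have "q mod 4 = 3"
    proof -
      have "odd Q" using ex by presburger
      then have "odd q" using fbar by (simp add: Q_def)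
      then have "q mod 4 = 1 \<or> q mod 4 = 3" by presburger
      moreover have "q mod 4 \<noteq> 1"
      proof
        assume "q mod 4 = 1"
        then have "Q mod 4 = 1" using power_mod[of q 4 fbar] by (simp add: Q_def)
        then show False using ex by simp
      qed
      ultimately show ?thesis by simp
    qed
    moreover have "odd f" using odd m by simp
    ultimately show "prop_P q d" by (simp add: prop_P_def f_def)
  qed
  \<comment> \<open>For \<open>l = 2\<close> the regular case means \<open>Q mod 4 = 1\<close>. Then
    \<open>Q + 1\<close> has valuation 1 and \<open>C = 3 / 4 + 1 / 4 = 1\<close>, whether or not
    \<open>prop_P q d\<close> holds.\<close>
  have C_pow: "C ^ (of_bool (l = 2) * of_bool (prop_P q d)) = 1"
    if l: "l \<in> ?S" and reg: "\<not> (l = 2 \<and> Q mod 4 = 3)" for l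
  proof (cases "l = 2")
    case True
    have "odd Q" using cong[OF l] True by (auto simp: cong_def odd_iff_mod_2_eq_one)
    then have "Q mod 4 = 1 \<or> Q mod 4 = 3" by presburger
    then have "Q mod 4 = 1" using reg True by simp
    then have "2 dvd Q + 1" "\<not> 4 dvd Q + 1" by presburger+
    then have "multiplicity 2 (Q + 1) = 1" by (intro multiplicity_eqI) auto
    then have "C = 1" using assms(10) by (simp add: Q_def power_int_minus)
    then show ?thesis by simp
  qed simp
  have factor: "euler_term l (A l) Q abs_summable_on UNIV \<and>
      (1 - 1 / real l) * infsum (euler_term l (A l) Q) UNIV =
       1 - real (l ^ multiplicity l (d * h)) * C ^ (of_bool (l = 2) * of_bool (prop_P q d)) /
           (real (l + 1) * real (l ^ multiplicity l (q ^ fbar - 1)))" if l: "l \<in> ?S" for l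
  proof (cases "l = 2 \<and> Q mod 4 = 3")
    case False
    show ?thesis
      using euler_term_regular[OF in_prime_factors_imp_prime[OF l] False, of "A l"] C_pow[OF l False]
      by (simp add: A_def Q_def add.commute)
  next
    case True
    have "C = 3 / 4 + 1 / 2 ^ Suc (multiplicity 2 (Q + 1))"
      using assms(10) by (simp add: Q_def power_int_diff power_int_minus field_simps)
    then show ?thesis
      using euler_term_exceptional[of Q] True even_case[OF l True]
      by (simp add: A_def Q_def del: power_Suc)
  qed
  \<comment> \<open>Only multiples of \<open>m\<close> contribute. Replacing \<open>w\<close> by
    \<open>m * w\<close> turns the exponent \<open>f * w\<close> into \<open>fbar * w\<close>, so
    that powers of \<open>Q\<close> appear.\<close>
  have "(\<Sum>\<^sub>\<infinity>w\<in>{w. dvd_infty w d}. delta_w a d w / real w) =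
      (\<Sum>\<^sub>\<infinity>w | dvd_infty w d. delta_w a d (m * w) / real (m * w))"
  proof (rule infsum_dvd_infty_multiples[OF d m_infty])
    fix w assume "dvd_infty w d" "\<not> m dvd w"
    then show "delta_w a d w / real w = 0" using delta f by (simp add: m)
  qed
  also have "\<dots> = (\<Sum>\<^sub>\<infinity>w | dvd_infty w d. 1 / real m *
      ((\<Prod>l\<in>?S. 1 - real l ^ A l / real l ^ Suc (multiplicity l (Q ^ w - 1))) / real w))"
  proof (rule infsum_cong)
    fix w assume "w \<in> {w. dvd_infty w d}"
    then have mw: "dvd_infty (m * w) d"
      using m_infty d by (auto simp: dvd_infty_iff prime_factors_product)
    have idx: "f * (m * w) = fbar * w" by (simp add: m)
    have Qw: "q ^ (fbar * w) = Q ^ w" by (simp add: Q_def power_mult)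
    have "delta_w a d (m * w) =
        (\<Prod>l\<in>?S. 1 - real l ^ A l / real l ^ Suc (multiplicity l (Q ^ w - 1)))"
      using delta[OF mw] unfolding idx Qw by simp
    then show "delta_w a d (m * w) / real (m * w) = 1 / real m *
      ((\<Prod>l\<in>?S. 1 - real l ^ A l / real l ^ Suc (multiplicity l (Q ^ w - 1))) / real w)"
      by simp
  qed
  also have "\<dots> = 1 / real m * (\<Prod>l\<in>?S. infsum (euler_term l (A l) Q) UNIV)"
    using infsum_inverse_prod_euler_terms[OF d Q cong, of A] factor
    by (simp only: infsum_cmult_right')
  finally have "delta_q a d = real (totient d) / (real d * real f) *
      (1 / real m * (\<Prod>l\<in>?S. infsum (euler_term l (A l) Q) UNIV))"
    by (simp only: delta_q_def assms(3) f_def)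
  \<comment> \<open>Here \<open>totient d / d\<close> becomes the product of the factors
    \<open>1 - 1 / l\<close>, and \<open>f * m\<close> becomes \<open>fbar\<close>.\<close>
  also have "\<dots> = 1 / real fbar * ((\<Prod>l\<in>?S. 1 - 1 / real l) * (\<Prod>l\<in>?S. infsum (euler_term l (A l) Q) UNIV))"
    using d by (simp add: totient_formula2 m)
  also have "\<dots> = 1 / real fbar * (\<Prod>l\<in>?S. (1 - 1 / real l) * infsum (euler_term l (A l) Q) UNIV)"
    by (simp add: prod.distrib)
  also have "\<dots> = 1 / real fbar *
    (\<Prod>l\<in>?S. 1 - real (l ^ multiplicity l (d * h)) * C ^ (of_bool (l = 2) * of_bool (prop_P q d)) /
           (real (l + 1) * real (l ^ multiplicity l (q ^ fbar - 1))))"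
    using factor by (intro arg_cong2[of _ _ _ _ "(*)"] prod.cong refl) blast
  finally show ?thesis .
qed

end
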